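(* Let $\sigma>0$, let $\mu$ be the isotropic Gaussian distribution $\mathcal N(0,\sigma^2 I)$ on $\mathbb R^d$, let $f\in\mathcal F$, $g=f\star\mu$, $x\in\mathbb R^d$, $y^{(0)}=g(x)_c>\frac12$ and $y^{(1)}=\nabla g_c(x)\neq 0$. Then the directional robustness $\mathbf R_v$ given by the first-order certification method is a non-increasing function of the angle $\cos^{-1}\Big(\frac{v^Ty^{(1)}}{\|v\|_2\|y^{(1)}\|_2}\Big)$ between $v$ and $y^{(1)}$; that is, for unit vectors $v,v'$, if the angle between $v$ and $y^{(1)}$ is at most the angle between $v'$ and $y^{(1)}$, then $\mathbf R_v\ge\mathbf R_{v'}$.
   Context: $\mathcal Y$ is a finite set of at least two classes, $\Delta^{\mathcal Y}$ the probability simplex over $\mathcal Y$, $\mathcal F$ the set of all measurable $f:\mathbb R^d\to\Delta^{\mathcal Y}$. $(f\star\mu)(x)=\int_{\mathbb R^d}f(x+z)\mu(z)\,dz$ and $\mathcal G^\mu_{\mathcal F}=\{f\star\mu:f\in\mathcal F\}$. A class $c\in\mathcal Y$ (the class predicted at $x$) is fixed, $h(z)_c$ denotes the $c$-th component of $h(z)$ and $h_c$ the corresponding scalar function. The first-order lower-bound probability function is $$\mathbf p_x(z)=\min\{h(z)_c:\ h\in\mathcal G^\mu_{\mathcal F},\ h(x)_c=y^{(0)},\ \nabla h_c(x)=y^{(1)}\},$$ and the first-order certified safety region is $\mathbf{SR}_L(x)=\{\delta\in\mathbb R^d:\ \mathbf p_x(x+\delta)>\tfrac12\}$ (a convex set).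 For a unit vector $v$, the directional robustness $\mathbf R_v\in[0,\infty]$ is $\mathbf R_v=\sup\{r\ge0:\ rv\in\mathbf{SR}_L(x)\}$, so that $rv\in\mathbf{SR}_L(x)$ for all $0\le r<\mathbf R_v$. *)

theory Defs
  imports "HOL-Analysis.Analysis"
begin

definition prob_simplex :: "(real ^ 'y) set" where
  "prob_simplex = {p. (\<forall>i. 0 \<le> p $ i) \<and> (\<Sum>i\<in>UNIV. p $ i) = 1}"

definition classifiers :: "(real ^ 'd \<Rightarrow> real ^ 'y) set" where
  "classifiers = {f. f \<in> borel_measurable borel \<and> (\<forall>z. f z \<in> prob_simplex)}"

text \<open>The smoothing measure is given by its Lebesgue density. Despite the star, the argument
  is \<open>x + z\<close> rather than \<open>x - z\<close>.\<close>

definition smoothing ::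
    "(real ^ 'd \<Rightarrow> real ^ 'y) \<Rightarrow> (real ^ 'd \<Rightarrow> real) \<Rightarrow> real ^ 'd \<Rightarrow> real ^ 'y"
    (infixl "\<star>" 70) where
  "(f \<star> \<mu>) x = (LINT z|lborel. \<mu> z *\<^sub>R f (x + z))"

definition smoothed_classifiers ::
    "(real ^ 'd \<Rightarrow> real) \<Rightarrow> (real ^ 'd \<Rightarrow> real ^ 'y) set" where
  "smoothed_classifiers \<mu> = {f \<star> \<mu> | f. f \<in> classifiers}"

definition gaussian_density :: "real \<Rightarrow> real ^ 'd \<Rightarrow> real" where
  "gaussian_density \<sigma> z =
     exp (- (norm z)\<^sup>2 / (2 * \<sigma>\<^sup>2)) / sqrt (2 * pi * \<sigma>\<^sup>2) ^ CARD('d)"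

text \<open>The minimum is rendered as an infimum in \<open>real\<close>; the two agree whenever the minimum
  is attained. The values are bounded below by \<open>0\<close>, so the infimum is the genuine one as soon
  as the constraints are feasible.\<close>

definition lower_bound_prob ::
    "(real ^ 'd \<Rightarrow> real) \<Rightarrow> 'y::finite \<Rightarrow> real ^ 'd \<Rightarrow> real \<Rightarrow> real ^ 'd \<Rightarrow> real ^ 'd \<Rightarrow> real" where
  "lower_bound_prob \<mu> c x y0 y1 z =
     Inf {h z $ c | h. h \<in> smoothed_classifiers \<mu> \<and> h x $ c = y0 \<and>
                       (GDERIV (\<lambda>u. h u $ c) x :> y1)}"

definition safety_region ::
    "(real ^ 'd \<Rightarrow> real) \<Rightarrow> 'y::finite \<Rightarrow> real ^ 'd \<Rightarrow> real \<Rightarrow> real ^ 'd \<Rightarrow> (real ^ 'd) set" where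
  "safety_region \<mu> c x y0 y1 = {\<delta>. lower_bound_prob \<mu> c x y0 y1 (x + \<delta>) > 1 / 2}"

definition directional_robustness ::
    "(real ^ 'd \<Rightarrow> real) \<Rightarrow> 'y::finite \<Rightarrow> real ^ 'd \<Rightarrow> real \<Rightarrow> real ^ 'd \<Rightarrow> real ^ 'd \<Rightarrow> ennreal" where
  "directional_robustness \<mu> c x y0 y1 v =
     Sup {ennreal r | r. r \<ge> 0 \<and> r *\<^sub>R v \<in> safety_region \<mu> c x y0 y1}"

definition angle_between :: "real ^ 'd \<Rightarrow> real ^ 'd \<Rightarrow> real" where
  "angle_between u w = arccos ((u \<bullet> w) / (norm u * norm w))"

end

(*
  The lower bound is monotone at each fixed radius. Let p and q have equal norm, with p at the
  smaller angle to y1, and let H be the reflection exchanging p and q. Replacing a test a by its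
  composition with H turns the value at p into the value at q, but gives the gradient the wrong
  component along p - q. Two-point symmetrisation (moving the larger value of each pair {u, H u}
  to the side of p) keeps the total mass, does not increase the value at q, and raises the
  component along p - q to at least the original one. A suitable convex combination of the
  reflected and the symmetrised test therefore satisfies both constraints exactly, and its value
  at q is at most the value of a at p.
*)
theory Submission
  imports Defs "HOL-Probability.Distributions"
begin

no_notation convolution (infix "\<star>" 50)

section \<open>Gaussian integrability and shifts of the density\<close>

text \<open>The exponential of the squared norm factorises over the coordinates, so the integral is
  a finite product of one-dimensional ones, each a multiple of a normal density.\<close>

lemma integrable_exp_neg_norm_sq:
  fixes k :: real
  assumes "k > 0"
  shows "integrable lborel (\<lambda>u::'a::euclidean_space. exp (- k * (norm u)\<^sup>2))"
proof (rule integrableI_nonneg)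
  have "integrable lborel (\<lambda>t::real. exp (- k * t\<^sup>2))"
  proof -
    \<comment> \<open>The standard deviation for which the exponent of the normal density is exactly
      \<open>- k * t\<^sup>2\<close>.\<close>
    define s where "s = 1 / sqrt (2 * k)"
    have "s > 0" and s: "2 * s\<^sup>2 = 1 / k"
      using assms by (simp_all add: s_def power_divide)
    have "integrable lborel (\<lambda>t. sqrt (2 * pi * s\<^sup>2) * normal_density 0 s t)"
      using \<open>s > 0\<close> by (intro integrable_mult_right integrable_normal_density)
    moreover have "sqrt (2 * pi * s\<^sup>2) * normal_density 0 s t = exp (- k * t\<^sup>2)" for t
      using \<open>s > 0\<close> by (simp add: normal_density_def s)
    ultimately show ?thesis
      by simp
  qed
  then have fin: "(\<integral>\<^sup>+t. ennreal (exp (- k * t\<^sup>2)) \<partial>lborel) < \<infinity>"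
    by (subst (asm) integrable_iff_bounded) simp
  have "exp (- k * (norm u)\<^sup>2) = (\<Prod>b\<in>Basis. exp (- k * (u \<bullet> b)\<^sup>2))" for u :: 'a
    unfolding power2_norm_eq_inner euclidean_inner[of u u]
    by (simp add: exp_sum[symmetric] sum_distrib_left sum_negf power2_eq_square)
  then have "(\<integral>\<^sup>+u. ennreal (exp (- k * (norm u)\<^sup>2)) \<partial>(lborel :: 'a measure))
      = (\<Prod>b\<in>(Basis::'a set). \<integral>\<^sup>+t. ennreal (exp (- k * t\<^sup>2)) \<partial>lborel)"
    by (subst nn_integral_lborel_prod[symmetric]) (simp_all add: prod_ennreal)
  also have "\<dots> < \<infinity>"
    using fin by (simp add: power_less_top_ennreal)
  finally show "(\<integral>\<^sup>+u. ennreal (exp (- k * (norm u)\<^sup>2)) \<partial>(lborel :: 'a measure)) < \<infinity>" .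
qed auto

lemma gaussian_density_pos: "\<sigma> > 0 \<Longrightarrow> gaussian_density \<sigma> u > 0"
  by (simp add: gaussian_density_def)

lemma borel_measurable_gaussian_density [measurable]:
  "gaussian_density \<sigma> \<in> borel_measurable borel"
  unfolding gaussian_density_def[abs_def] by measurable

text \<open>Completing the square bounds the linear exponent by a constant plus half of the Gaussian
  exponent. The other half still decays and makes the product integrable.\<close>

lemma integrable_gaussian_exp_norm:
  assumes "\<sigma> > 0"
  shows "integrable lborel (\<lambda>u. gaussian_density \<sigma> u * exp (C * norm u))"
proof (rule Bochner_Integration.integrable_bound)
  let ?D = "exp (C\<^sup>2 * \<sigma>\<^sup>2) / sqrt (2 * pi * \<sigma>\<^sup>2) ^ CARD('a)"
  show "integrable lborel (\<lambda>u::real^'a. ?D * exp (- (1 / (4 * \<sigma>\<^sup>2)) * (norm u)\<^sup>2))"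
    using assms by (intro integrable_mult_right integrable_exp_neg_norm_sq) simp
  have "gaussian_density \<sigma> u * exp (C * norm u) \<le> ?D * exp (- (1 / (4 * \<sigma>\<^sup>2)) * (norm u)\<^sup>2)"
    for u :: "real^'a"
  proof -
    have "0 \<le> (norm u / (2 * \<sigma>) - C * \<sigma>)\<^sup>2"
      by simp
    then have "C * norm u \<le> C\<^sup>2 * \<sigma>\<^sup>2 + (norm u)\<^sup>2 / (4 * \<sigma>\<^sup>2)"
      using assms by (simp add: power2_diff power_divide power_mult_distrib mult.commute add.commute)
    then have "- (norm u)\<^sup>2 / (2 * \<sigma>\<^sup>2) + C * norm u
        \<le> C\<^sup>2 * \<sigma>\<^sup>2 + - (1 / (4 * \<sigma>\<^sup>2)) * (norm u)\<^sup>2"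
      by simp
    then have "exp (- (norm u)\<^sup>2 / (2 * \<sigma>\<^sup>2)) * exp (C * norm u)
        \<le> exp (C\<^sup>2 * \<sigma>\<^sup>2) * exp (- (1 / (4 * \<sigma>\<^sup>2)) * (norm u)\<^sup>2)"
      unfolding exp_add[symmetric] by simp
    then show ?thesis
      using assms by (simp add: gaussian_density_def divide_right_mono)
  qed
  then show "AE u in lborel. norm (gaussian_density \<sigma> u * exp (C * norm u))
      \<le> norm (?D * exp (- (1 / (4 * \<sigma>\<^sup>2)) * (norm (u::real^'a))\<^sup>2))"
    using assms by (intro AE_I2) (simp add: gaussian_density_pos less_imp_le abs_mult)
qed measurable

text \<open>A criterion by exponential growth. Bounded integrands are the case \<open>C = 0\<close>;
  linear ones are covered because \<open>norm u\<close> is at most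
  \<open>exp (norm u)\<close>.\<close>

lemma integrable_gaussian_exp_bounded:
  fixes F :: "real ^ 'd \<Rightarrow> 'b::{banach, second_countable_topology}"
  assumes "\<sigma> > 0" and [measurable]: "F \<in> borel_measurable borel"
    and F: "\<And>u. norm (F u) \<le> K * exp (C * norm u)"
  shows "integrable lborel (\<lambda>u. gaussian_density \<sigma> u *\<^sub>R F u)"
proof (rule Bochner_Integration.integrable_bound)
  show "integrable lborel (\<lambda>u::real^'d. K * (gaussian_density \<sigma> u * exp (C * norm u)))"
    using assms by (intro integrable_mult_right integrable_gaussian_exp_norm)
  have "norm (gaussian_density \<sigma> u *\<^sub>R F u) \<le> norm (K * (gaussian_density \<sigma> u * exp (C * norm u)))" for u
  proof -
    have "norm (gaussian_density \<sigma> u *\<^sub>R F u) = gaussian_density \<sigma> u * norm (F u)"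
      using gaussian_density_pos[OF assms(1), of u] by simp
    also have "\<dots> \<le> gaussian_density \<sigma> u * (K * exp (C * norm u))"
      using gaussian_density_pos[OF assms(1), of u] F by (intro mult_left_mono) auto
    also have "\<dots> \<le> norm (K * (gaussian_density \<sigma> u * exp (C * norm u)))"
      by (simp add: mult_ac)
    finally show ?thesis .
  qed
  then show "AE u in lborel. norm (gaussian_density \<sigma> u *\<^sub>R F u) \<le> norm (K * (gaussian_density \<sigma> u * exp (C * norm u)))"
    by simp
qed measurable

lemma lborel_integral_translate:
  fixes f :: "'a::euclidean_space \<Rightarrow> 'b::{banach, second_countable_topology}"
  assumes [measurable]: "f \<in> borel_measurable borel"
  shows "(LINT u|lborel. f (c + u)) = (LINT u|lborel. f u)"
proof -
  have "(LINT u|lborel. f u) = (LINT u|distr lborel borel ((+) c). f u)"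
    by (simp add: lborel_distr_plus)
  also have "\<dots> = (LINT u|lborel. f (c + u))"
    by (rule integral_distr) measurable
  finally show ?thesis ..
qed

text \<open>The likelihood ratio of two Gaussians with different centres, from expanding the square.
  It makes the dependence on the shift smooth and explicit, so that a Gaussian average can be
  differentiated without any regularity of the averaged function.\<close>

lemma gaussian_density_shift:
  assumes "\<sigma> > 0"
  shows "gaussian_density \<sigma> (u - \<delta>)
       = gaussian_density \<sigma> u * exp ((u \<bullet> \<delta> - (norm \<delta>)\<^sup>2 / 2) / \<sigma>\<^sup>2)"
proof -
  have "(norm (u - \<delta>))\<^sup>2 = (norm u)\<^sup>2 + (norm \<delta>)\<^sup>2 - 2 * (u \<bullet> \<delta>)"
    by (simp add: power2_norm_eq_inner inner_diff_left inner_diff_right inner_commute)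
  then have "- (norm (u - \<delta>))\<^sup>2 / (2 * \<sigma>\<^sup>2)
      = - (norm u)\<^sup>2 / (2 * \<sigma>\<^sup>2) + (u \<bullet> \<delta> - (norm \<delta>)\<^sup>2 / 2) / \<sigma>\<^sup>2"
    using assms by (simp only:) (simp add: field_simps)
  then have "exp (- (norm (u - \<delta>))\<^sup>2 / (2 * \<sigma>\<^sup>2))
      = exp (- (norm u)\<^sup>2 / (2 * \<sigma>\<^sup>2)) * exp ((u \<bullet> \<delta> - (norm \<delta>)\<^sup>2 / 2) / \<sigma>\<^sup>2)"
    by (simp only: exp_add)
  then show ?thesis
    by (simp add: gaussian_density_def)
qed

lemma integrable_gaussian_shift:
  assumes "\<sigma> > 0"
  shows "integrable lborel (\<lambda>u. gaussian_density \<sigma> (u - \<delta>))"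
proof -
  have "integrable lborel (\<lambda>u. gaussian_density \<sigma> u *\<^sub>R exp ((u \<bullet> \<delta> - (norm \<delta>)\<^sup>2 / 2) / \<sigma>\<^sup>2))"
  proof (rule integrable_gaussian_exp_bounded)
    fix u
    have "u \<bullet> \<delta> \<le> norm \<delta> * norm u"
      using norm_cauchy_schwarz[of u \<delta>] by (simp add: mult.commute)
    then have "u \<bullet> \<delta> - (norm \<delta>)\<^sup>2 / 2 \<le> norm \<delta> * norm u"
      using zero_le_power2[of "norm \<delta>"] by linarith
    then have "(u \<bullet> \<delta> - (norm \<delta>)\<^sup>2 / 2) / \<sigma>\<^sup>2 \<le> (norm \<delta> * norm u) / \<sigma>\<^sup>2"
      by (intro divide_right_mono) auto
    then show "norm (exp ((u \<bullet> \<delta> - (norm \<delta>)\<^sup>2 / 2) / \<sigma>\<^sup>2)) \<le> 1 * exp ((norm \<delta> / \<sigma>\<^sup>2) * norm u)"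
      by simp
  qed (use assms in measurable)
  then show ?thesis
    using assms by (simp add: gaussian_density_shift)
qed

section \<open>The gradient of a Gaussian average as a first moment\<close>

lemma abs_exp_minus_linear_le:
  fixes t :: real
  shows "\<bar>exp t - 1 - t\<bar> \<le> t\<^sup>2 * exp \<bar>t\<bar>"
proof -
  obtain s where s: "\<bar>s\<bar> \<le> \<bar>t\<bar>" "exp t = (\<Sum>m<2. t ^ m / fact m) + exp s / fact 2 * t ^ 2"
    using Maclaurin_exp_le[of t 2] by blast
  then have "\<bar>exp t - 1 - t\<bar> = exp s / 2 * t\<^sup>2"
    by (simp add: numeral_2_eq_2)
  also have "\<dots> \<le> exp \<bar>t\<bar> * t\<^sup>2"
  proof (rule mult_right_mono)
    have "exp s \<le> exp \<bar>t\<bar>"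
      using s(1) by simp
    then show "exp s / 2 \<le> exp \<bar>t\<bar>"
      using exp_gt_zero[of s] by linarith
  qed simp
  finally show ?thesis
    by (simp add: mult.commute)
qed

text \<open>First-order expansion of the likelihood ratio in \<delta>. The error is quadratic in
  \<open>norm \<delta>\<close>, with a factor that is free of \<delta> and grows only exponentially
  in \<open>norm u\<close>, hence is integrable against the Gaussian. The term
  \<open>1 / \<sigma>\<^sup>2\<close> in that factor pays for dropping the quadratic part of the
  exponent.\<close>

lemma exp_quadratic_remainder:
  fixes u \<delta> :: "'a::real_inner"
  assumes "\<sigma> > 0" "norm \<delta> \<le> 1"
  defines "B \<equiv> (norm u + 1) / \<sigma>\<^sup>2"
  shows "\<bar>exp ((u \<bullet> \<delta> - (norm \<delta>)\<^sup>2 / 2) / \<sigma>\<^sup>2) - 1 - (u \<bullet> \<delta>) / \<sigma>\<^sup>2\<bar>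
       \<le> (norm \<delta>)\<^sup>2 * ((2 + 1 / \<sigma>\<^sup>2) * exp (2 * B))"
proof -
  define t where "t = (u \<bullet> \<delta> - (norm \<delta>)\<^sup>2 / 2) / \<sigma>\<^sup>2"
  have B: "B \<ge> 0"
    by (simp add: B_def)
  have d2: "(norm \<delta>)\<^sup>2 \<le> norm \<delta>"
    using assms(2) by (simp add: power2_eq_square mult_left_le)
  have "\<bar>u \<bullet> \<delta> - (norm \<delta>)\<^sup>2 / 2\<bar> \<le> \<bar>u \<bullet> \<delta>\<bar> + (norm \<delta>)\<^sup>2 / 2"
    using abs_triangle_ineq4[of "u \<bullet> \<delta>" "(norm \<delta>)\<^sup>2 / 2"] by simp
  also have "\<dots> \<le> norm u * norm \<delta> + norm \<delta>"
    using Cauchy_Schwarz_ineq2[of u \<delta>] d2 norm_ge_zero[of \<delta>] by linarith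
  also have "\<dots> = norm \<delta> * (norm u + 1)"
    by (simp add: algebra_simps)
  finally have t: "\<bar>t\<bar> \<le> norm \<delta> * B"
    by (simp add: t_def B_def divide_right_mono abs_divide)
  have tB: "\<bar>t\<bar> \<le> B"
    using t mult_right_mono[OF assms(2) B] by simp
  have t2: "t\<^sup>2 \<le> (norm \<delta>)\<^sup>2 * B\<^sup>2"
    using power_mono[OF t, of 2] by (simp add: power_mult_distrib)
  \<comment> \<open>The polynomial factor is traded for an exponential one, to fit the exponential
    growth criterion.\<close>
  have B2: "B\<^sup>2 \<le> 2 * exp B"
    using exp_lower_Taylor_quadratic[OF B] B by (simp add: field_simps)
  have "\<bar>exp t - 1 - t\<bar> \<le> t\<^sup>2 * exp \<bar>t\<bar>"
    by (rule abs_exp_minus_linear_le)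
  also have "\<dots> \<le> ((norm \<delta>)\<^sup>2 * B\<^sup>2) * exp B"
    using t2 tB by (intro mult_mono) auto
  also have "\<dots> \<le> ((norm \<delta>)\<^sup>2 * (2 * exp B)) * exp B"
    using B2 by (intro mult_right_mono mult_left_mono) auto
  also have "\<dots> = (norm \<delta>)\<^sup>2 * (2 * exp (2 * B))"
    by (simp add: exp_double power2_eq_square)
  finally have 1: "\<bar>exp t - 1 - t\<bar> \<le> (norm \<delta>)\<^sup>2 * (2 * exp (2 * B))" .
  have "t - (u \<bullet> \<delta>) / \<sigma>\<^sup>2 = - ((norm \<delta>)\<^sup>2 * (1 / (2 * \<sigma>\<^sup>2)))"
    using assms(1) by (simp add: t_def field_simps)
  then have "\<bar>t - (u \<bullet> \<delta>) / \<sigma>\<^sup>2\<bar> = (norm \<delta>)\<^sup>2 * (1 / (2 * \<sigma>\<^sup>2))"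
    by simp
  also have "\<dots> \<le> (norm \<delta>)\<^sup>2 * ((1 / \<sigma>\<^sup>2) * exp (2 * B))"
  proof (rule mult_left_mono)
    have "1 / (2 * \<sigma>\<^sup>2) \<le> (1 / \<sigma>\<^sup>2) * 1"
      using assms(1) by (simp add: field_simps)
    also have "\<dots> \<le> (1 / \<sigma>\<^sup>2) * exp (2 * B)"
      using B by (intro mult_left_mono) auto
    finally show "1 / (2 * \<sigma>\<^sup>2) \<le> (1 / \<sigma>\<^sup>2) * exp (2 * B)" .
  qed simp
  finally have 2: "\<bar>t - (u \<bullet> \<delta>) / \<sigma>\<^sup>2\<bar> \<le> (norm \<delta>)\<^sup>2 * ((1 / \<sigma>\<^sup>2) * exp (2 * B))" .
  have "\<bar>exp t - 1 - (u \<bullet> \<delta>) / \<sigma>\<^sup>2\<bar>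
      \<le> (norm \<delta>)\<^sup>2 * (2 * exp (2 * B)) + (norm \<delta>)\<^sup>2 * ((1 / \<sigma>\<^sup>2) * exp (2 * B))"
    using 1 2 by linarith
  also have "\<dots> = (norm \<delta>)\<^sup>2 * ((2 + 1 / \<sigma>\<^sup>2) * exp (2 * B))"
    by (simp add: algebra_simps)
  finally show ?thesis
    by (simp add: t_def)
qed

text \<open>These are exactly the single components of classifiers when there are at least two classes.\<close>

definition soft_tests :: "('a::topological_space \<Rightarrow> real) set" where
  "soft_tests = {a. a \<in> borel_measurable borel \<and> (\<forall>z. 0 \<le> a z \<and> a z \<le> 1)}"

lemma soft_tests_measurable: "a \<in> soft_tests \<Longrightarrow> a \<in> borel_measurable borel"
  and soft_tests_nonneg: "a \<in> soft_tests \<Longrightarrow> 0 \<le> a z"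
  and soft_tests_le_1: "a \<in> soft_tests \<Longrightarrow> a z \<le> 1"
  by (simp_all add: soft_tests_def)

definition smooth :: "real \<Rightarrow> (real ^ 'd \<Rightarrow> real) \<Rightarrow> real ^ 'd \<Rightarrow> real" where
  "smooth \<sigma> a w = (LINT z|lborel. gaussian_density \<sigma> z * a (w + z))"

text \<open>Translation invariance moves the displacement from the test, which is merely measurable,
  onto the smooth density.\<close>

lemma smooth_shift:
  assumes a: "a \<in> soft_tests"
  shows "smooth \<sigma> a (x + \<delta>) = (LINT u|lborel. gaussian_density \<sigma> (u - \<delta>) * a (x + u))"
proof -
  note [measurable] = soft_tests_measurable[OF a]
  show ?thesis
    unfolding smooth_def
    using lborel_integral_translate[of "\<lambda>u. gaussian_density \<sigma> (u - \<delta>) * a (x + u)" \<delta>]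
    by (simp add: add.assoc)
qed

text \<open>With the displacement carried by the density, the expansion of the likelihood ratio can
  be integrated term by term: its linear term produces the first moment, and the error is at most a
  constant times the square of \<open>norm \<delta>\<close>. The gradient constraint thereby becomes
  a linear condition on the test.\<close>

lemma GDERIV_smooth:
  fixes x :: "real ^ 'd"
  assumes "\<sigma> > 0" and a: "a \<in> soft_tests"
  shows "GDERIV (smooth \<sigma> a) x :>
    (1 / \<sigma>\<^sup>2) *\<^sub>R (LINT u|lborel. gaussian_density \<sigma> u *\<^sub>R a (x + u) *\<^sub>R u)"
    (is "GDERIV _ _ :> _ *\<^sub>R ?M")
proof -
  note [measurable] = soft_tests_measurable[OF a]
  have a01: "\<bar>a z\<bar> \<le> 1" for z
    using soft_tests_nonneg[OF a, of z] soft_tests_le_1[OF a, of z] by simp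
  have bnd: "norm (a (x + u) *\<^sub>R u) \<le> 1 * exp (1 * norm u)" for u
    using mult_mono[OF a01[of "x + u"], of "norm u" "exp (norm u)"] exp_ge_add_one_self[of "norm u"]
    by simp
  have intM: "integrable lborel (\<lambda>u. gaussian_density \<sigma> u *\<^sub>R a (x + u) *\<^sub>R u)"
    by (rule integrable_gaussian_exp_bounded[OF assms(1) _ bnd]) measurable
  have int0: "integrable lborel (\<lambda>u. gaussian_density \<sigma> u * a (x + u))"
    using integrable_gaussian_exp_bounded[OF assms(1), of "\<lambda>u. a (x + u)" 1 0] a01 by simp
  have intd: "integrable lborel (\<lambda>u. gaussian_density \<sigma> (u - \<delta>) * a (x + u))" for \<delta>
    using a01 by (intro Bochner_Integration.integrable_bound[OF integrable_gaussian_shift[OF assms(1), of \<delta>]])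
      (auto simp: abs_mult mult_left_le)
  define G where "G u = (2 + 1 / \<sigma>\<^sup>2) * exp (2 * ((norm u + 1) / \<sigma>\<^sup>2))" for u :: "real ^ 'd"
  have G0: "G u \<ge> 0" for u
    by (simp add: G_def)
  have intG: "integrable lborel (\<lambda>u. gaussian_density \<sigma> u * G u)"
  proof -
    have bndG: "norm (G u) \<le> ((2 + 1 / \<sigma>\<^sup>2) * exp (2 / \<sigma>\<^sup>2)) * exp ((2 / \<sigma>\<^sup>2) * norm u)" for u
      unfolding G_def by (simp add: exp_add[symmetric] add_divide_distrib algebra_simps)
    have "G \<in> borel_measurable borel"
      unfolding G_def by measurable
    from integrable_gaussian_exp_bounded[OF assms(1) this bndG] show ?thesis
      by simp
  qed
  define K where "K = (LINT u|lborel. gaussian_density \<sigma> u * G u)"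
  have K0: "K \<ge> 0"
    unfolding K_def using G0 gaussian_density_pos[OF assms(1)]
    by (intro integral_nonneg_AE AE_I2 mult_nonneg_nonneg) (auto intro: less_imp_le)
  have rem: "\<bar>smooth \<sigma> a (x + \<delta>) - smooth \<sigma> a x - \<delta> \<bullet> ((1 / \<sigma>\<^sup>2) *\<^sub>R ?M)\<bar> \<le> (norm \<delta>)\<^sup>2 * K"
    if \<delta>: "norm \<delta> \<le> 1" for \<delta>
  proof -
    have lin: "integrable lborel (\<lambda>u. (gaussian_density \<sigma> u *\<^sub>R a (x + u) *\<^sub>R u) \<bullet> \<delta>)"
      by (rule integrable_inner_left) (rule intM)
    have "\<delta> \<bullet> ((1 / \<sigma>\<^sup>2) *\<^sub>R ?M) = (1 / \<sigma>\<^sup>2) * (?M \<bullet> \<delta>)"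
      by (simp add: inner_commute)
    also have "\<dots> = (LINT u|lborel. (1 / \<sigma>\<^sup>2) * ((gaussian_density \<sigma> u *\<^sub>R a (x + u) *\<^sub>R u) \<bullet> \<delta>))"
      by (simp only: integral_inner_left[OF intM] integral_mult_right_zero)
    finally have "smooth \<sigma> a (x + \<delta>) - smooth \<sigma> a x - \<delta> \<bullet> ((1 / \<sigma>\<^sup>2) *\<^sub>R ?M)
        = (LINT u|lborel. gaussian_density \<sigma> (u - \<delta>) * a (x + u) - gaussian_density \<sigma> u * a (x + u)
            - (1 / \<sigma>\<^sup>2) * ((gaussian_density \<sigma> u *\<^sub>R a (x + u) *\<^sub>R u) \<bullet> \<delta>))"
      using intd[of \<delta>] int0 lin smooth_shift[OF a, of \<sigma> x \<delta>]
      by (simp add: smooth_def)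
    also have "\<bar>\<dots>\<bar> \<le> (LINT u|lborel. (norm \<delta>)\<^sup>2 * (gaussian_density \<sigma> u * G u))"
    proof (rule integral_abs_bound_integral)
      fix u
      have "gaussian_density \<sigma> (u - \<delta>) * a (x + u) - gaussian_density \<sigma> u * a (x + u)
            - (1 / \<sigma>\<^sup>2) * ((gaussian_density \<sigma> u *\<^sub>R a (x + u) *\<^sub>R u) \<bullet> \<delta>)
          = gaussian_density \<sigma> u * a (x + u) *
            (exp ((u \<bullet> \<delta> - (norm \<delta>)\<^sup>2 / 2) / \<sigma>\<^sup>2) - 1 - (u \<bullet> \<delta>) / \<sigma>\<^sup>2)" (is "?L = _")
        by (simp add: gaussian_density_shift[OF assms(1)] algebra_simps)
      then have "\<bar>?L\<bar> = gaussian_density \<sigma> u * \<bar>a (x + u)\<bar> *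
            \<bar>exp ((u \<bullet> \<delta> - (norm \<delta>)\<^sup>2 / 2) / \<sigma>\<^sup>2) - 1 - (u \<bullet> \<delta>) / \<sigma>\<^sup>2\<bar>"
        using gaussian_density_pos[OF assms(1), of u] by (simp add: abs_mult)
      also have "\<dots> \<le> gaussian_density \<sigma> u * 1 * ((norm \<delta>)\<^sup>2 * G u)"
        unfolding G_def
        using gaussian_density_pos[OF assms(1), of u] a01 exp_quadratic_remainder[OF assms(1) \<delta>, of u]
        by (intro mult_mono mult_left_mono) auto
      finally show "\<bar>?L\<bar> \<le> (norm \<delta>)\<^sup>2 * (gaussian_density \<sigma> u * G u)"
        by (simp add: mult_ac)
    qed (use intd[of \<delta>] int0 lin intG in \<open>auto intro!: Bochner_Integration.integrable_diff integrable_mult_right\<close>)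
    also have "\<dots> = (norm \<delta>)\<^sup>2 * K"
      by (simp add: K_def)
    finally show ?thesis .
  qed
  show ?thesis
    unfolding gderiv_def has_derivative_at
  proof (intro conjI bounded_linear_inner_left LIM_I)
    fix e :: real
    assume "e > 0"
    \<comment> \<open>The bound 1 is the range of the remainder estimate; \<open>K + 1\<close> keeps
      the quotient meaningful when \<open>K\<close> is 0.\<close>
    define s where "s = min 1 (e / (K + 1))"
    have "s > 0"
      using \<open>e > 0\<close> K0 by (simp add: s_def)
    moreover have "norm (smooth \<sigma> a (x + \<delta>) - smooth \<sigma> a x - \<delta> \<bullet> ((1 / \<sigma>\<^sup>2) *\<^sub>R ?M)) / norm \<delta> < e"
      if "\<delta> \<noteq> 0" "norm \<delta> < s" for \<delta>
    proof -
      have "norm (smooth \<sigma> a (x + \<delta>) - smooth \<sigma> a x - \<delta> \<bullet> ((1 / \<sigma>\<^sup>2) *\<^sub>R ?M)) / norm \<delta>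
          \<le> ((norm \<delta>)\<^sup>2 * K) / norm \<delta>"
        using rem[of \<delta>] that by (intro divide_right_mono) (auto simp: s_def)
      also have "\<dots> = norm \<delta> * K"
        using that by (simp add: power2_eq_square)
      also have "\<dots> \<le> norm \<delta> * (K + 1)"
        by (intro mult_left_mono) auto
      also have "\<dots> < e"
        using that K0 by (simp add: s_def pos_less_divide_eq)
      finally show ?thesis .
    qed
    ultimately show "\<exists>s>0. \<forall>\<delta>. \<delta> \<noteq> 0 \<and> norm (\<delta> - 0) < s \<longrightarrow>
       norm (norm (smooth \<sigma> a (x + \<delta>) - smooth \<sigma> a x - \<delta> \<bullet> ((1 / \<sigma>\<^sup>2) *\<^sub>R ?M)) / norm \<delta> - 0) < e"
      by (intro exI[of _ s]) simp
  qed
qed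

section \<open>Orthogonal invariance of Lebesgue measure and antisymmetric integrands\<close>

text \<open>As in the uniqueness proof for Haar measure: Fubini and translation invariance show that
  \<open>T -` A\<close> and \<open>A\<close> have the same measure up to the common factor given by the unit ball, which
  \<open>T\<close> preserves.\<close>

lemma lborel_distr_orthogonal_transformation:
  fixes T :: "'a::euclidean_space \<Rightarrow> 'a"
  assumes T: "orthogonal_transformation T"
  shows "distr lborel borel T = lborel"
proof (rule measure_eqI)
  fix A :: "'a set"
  assume "A \<in> sets (distr lborel borel T)"
  then have A [measurable]: "A \<in> sets borel"
    by simp
  interpret linear T
    using T by (rule orthogonal_transformation_linear)
  have [measurable]: "T \<in> borel_measurable borel"
    by (intro borel_measurable_continuous_onI linear_continuous_on linear_linear[THEN iffD2] linear_axioms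
        linear_conv_bounded_linear[THEN iffD1])
  have [measurable]: "T -` A \<in> sets borel"
    using measurable_sets_borel[of T borel A] by simp
  obtain S where S: "\<And>y. T (S y) = y"
    using orthogonal_transformation_surj[OF T] by (metis surj_f_inv_f)
  define B where "B = ball (0::'a) 1"
  have B [measurable]: "B \<in> sets borel"
    by (simp add: B_def)
  have B_T: "- T x \<in> B \<longleftrightarrow> x \<in> B" for x
    by (simp add: B_def orthogonal_transformation_norm[OF T])
  have tr: "(\<integral>\<^sup>+y. f (c + y) \<partial>lborel) = (\<integral>\<^sup>+y. f y \<partial>lborel)"
    if [measurable]: "f \<in> borel_measurable borel" for f and c :: 'a
  proof -
    have "(\<integral>\<^sup>+y. f y \<partial>lborel) = (\<integral>\<^sup>+y. f y \<partial>distr lborel borel ((+) c))"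
      by (simp add: lborel_distr_plus)
    also have "\<dots> = (\<integral>\<^sup>+y. f (c + y) \<partial>lborel)"
      by (rule nn_integral_distr) measurable
    finally show ?thesis ..
  qed
  have "emeasure lborel (T -` A) * emeasure lborel B
      = (\<integral>\<^sup>+x. indicator A (T x) * emeasure lborel B \<partial>lborel)"
    by (subst nn_integral_multc) (auto simp: indicator_vimage[symmetric] nn_integral_indicator)
  also have "\<dots> = (\<integral>\<^sup>+x. \<integral>\<^sup>+y. indicator A (T x) * indicator B (- T x + y) \<partial>lborel \<partial>lborel)"
    by (subst nn_integral_cmult) (simp_all add: tr[of "indicator B"] del: uminus_add_conv_diff)
  also have "\<dots> = (\<integral>\<^sup>+y. \<integral>\<^sup>+x. indicator A (T x) * indicator B (- T x + y) \<partial>lborel \<partial>lborel)"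
    by (rule lborel_pair.Fubini') measurable
  also have "\<dots> = (\<integral>\<^sup>+y. \<integral>\<^sup>+x. indicator A (T x + y) * indicator B x \<partial>lborel \<partial>lborel)"
  proof (rule nn_integral_cong)
    fix y :: 'a
    \<comment> \<open>Translating \<open>x\<close> by a preimage \<open>S y\<close> of
      \<open>y\<close> replaces \<open>T x\<close> by \<open>y + T x\<close>. The argument of the
      ball indicator becomes \<open>- T x\<close>, which lies in the ball exactly when
      \<open>x\<close> does.\<close>
    have "(\<integral>\<^sup>+x. indicator A (T x) * indicator B (- T x + y) \<partial>lborel)
        = (\<integral>\<^sup>+x. indicator A (T (S y + x)) * indicator B (- T (S y + x) + y) \<partial>lborel)"
      by (rule tr[symmetric]) measurable
    also have "\<dots> = (\<integral>\<^sup>+x. indicator A (T x + y) * indicator B x \<partial>lborel)"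
      by (simp add: add S B_T indicator_def add.commute)
    finally show "(\<integral>\<^sup>+x. indicator A (T x) * indicator B (- T x + y) \<partial>lborel)
        = (\<integral>\<^sup>+x. indicator A (T x + y) * indicator B x \<partial>lborel)" .
  qed
  also have "\<dots> = (\<integral>\<^sup>+x. \<integral>\<^sup>+y. indicator A (T x + y) * indicator B x \<partial>lborel \<partial>lborel)"
    by (rule lborel_pair.Fubini') measurable
  also have "\<dots> = emeasure lborel A * emeasure lborel B"
    by (subst nn_integral_multc) (auto simp: tr[of "indicator A"] nn_integral_cmult)
  finally have "emeasure lborel (T -` A) * emeasure lborel B = emeasure lborel A * emeasure lborel B" .
  moreover have "emeasure lborel B \<noteq> 0" "emeasure lborel B \<noteq> \<infinity>"
    using unit_ball_vol_pos[of "real DIM('a)", THEN less_imp_neq] by (auto simp: B_def emeasure_ball)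
  ultimately show "emeasure (distr lborel borel T) A = emeasure lborel A"
    by (simp add: emeasure_distr) (metis mult_divide_eq_ennreal)
qed simp

lemma integral_orthogonal_transformation:
  fixes f :: "'a::euclidean_space \<Rightarrow> 'b::{banach, second_countable_topology}" and T :: "'a \<Rightarrow> 'a"
  assumes T: "orthogonal_transformation T" and [measurable]: "f \<in> borel_measurable borel"
  shows "(LINT u|lborel. f (T u)) = (LINT u|lborel. f u)" (is ?integral)
    and "integrable lborel f \<Longrightarrow> integrable lborel (\<lambda>u. f (T u))" (is "_ \<Longrightarrow> ?integrable")
proof -
  have "bounded_linear T"
    using T by (simp add: orthogonal_transformation_linear linear_conv_bounded_linear[symmetric])
  then have [measurable]: "T \<in> borel_measurable borel"
    by (intro borel_measurable_continuous_onI linear_continuous_on)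
  have "(LINT u|lborel. f u) = (LINT u|distr lborel borel T. f u)"
    by (simp add: lborel_distr_orthogonal_transformation[OF T])
  also have "\<dots> = (LINT u|lborel. f (T u))"
    by (rule integral_distr) measurable
  finally show ?integral ..
  show ?integrable if "integrable lborel f"
    by (rule integrable_distr[of T lborel borel])
      (use that in \<open>simp_all add: lborel_distr_orthogonal_transformation[OF T]\<close>)
qed

text \<open>Substituting \<open>T u\<close> preserves the integral and, by antisymmetry, turns the
  integrand into \<open>- w (T u) * \<eta> u\<close>. Averaging both forms gives half the integral
  of \<open>(w u - w (T u)) * \<eta> u\<close>, whose sign is known pointwise.\<close>

lemma integral_antisymmetric_nonpos:
  fixes w \<eta> :: "'a::euclidean_space \<Rightarrow> real"
  assumes T: "orthogonal_transformation T"
    and int: "integrable lborel (\<lambda>u. w u * \<eta> u)"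
    and anti: "\<And>u. \<eta> (T u) = - \<eta> u"
    and le: "\<And>u. (w u - w (T u)) * \<eta> u \<le> 0"
  shows "(LINT u|lborel. w u * \<eta> u) \<le> 0"
proof -
  let ?f = "\<lambda>u. w u * \<eta> u"
  have meas: "?f \<in> borel_measurable borel"
    using borel_measurable_integrable[OF int] by simp
  note T_int = integral_orthogonal_transformation[OF T meas]
  have "2 * (LINT u|lborel. ?f u) = (LINT u|lborel. ?f u) + (LINT u|lborel. ?f (T u))"
    using T_int(1) by simp
  also have "\<dots> = (LINT u|lborel. ?f u + ?f (T u))"
    using int T_int(2)[OF int] by simp
  also have "\<dots> = (LINT u|lborel. (w u - w (T u)) * \<eta> u)"
    by (simp add: anti algebra_simps)
  also have "\<dots> \<le> 0"
  proof -
    have "0 \<le> (LINT u|lborel. - ((w u - w (T u)) * \<eta> u))"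
      using le by (intro integral_nonneg_AE) simp
    then show ?thesis
      by simp
  qed
  finally show ?thesis
    by simp
qed

text \<open>For an invariant weight the difference \<open>w u - w (T u)\<close> vanishes, so the
  sign lemma applies to both \<open>w\<close> and \<open>- w\<close>. This yields the quantities
  that rearranging values within pairs \<open>u\<close>, \<open>T u\<close> leaves
  unchanged.\<close>

lemma integral_antisymmetric_eq_0:
  fixes w \<eta> :: "'a::euclidean_space \<Rightarrow> real"
  assumes T: "orthogonal_transformation T"
    and int: "integrable lborel (\<lambda>u. w u * \<eta> u)"
    and anti: "\<And>u. \<eta> (T u) = - \<eta> u"
    and sym: "\<And>u. w (T u) = w u"
  shows "(LINT u|lborel. w u * \<eta> u) = 0"
proof -
  have "(LINT u|lborel. w u * \<eta> u) \<le> 0"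
    using assms by (intro integral_antisymmetric_nonpos[OF T]) auto
  moreover have "(LINT u|lborel. (- w u) * \<eta> u) \<le> 0"
    using assms by (intro integral_antisymmetric_nonpos[OF T]) auto
  ultimately show ?thesis
    by simp
qed

section \<open>Reflections in hyperplanes\<close>

text \<open>The vector \<open>n\<close> is a normal of any length. For \<open>n = 0\<close> the
  formula is the identity, so the reflection for a pair of points \<open>p\<close>, \<open>q\<close>
  is still meaningful when they coincide.\<close>

definition reflect :: "'a::real_inner \<Rightarrow> 'a \<Rightarrow> 'a" where
  "reflect n u = u - (2 * (u \<bullet> n) / (n \<bullet> n)) *\<^sub>R n"

lemma reflect_inner_normal: "reflect n u \<bullet> n = - (u \<bullet> n)"
  by (cases "n = 0") (simp_all add: reflect_def inner_diff_left)

lemma reflect_inner_orthogonal: "q \<bullet> n = 0 \<Longrightarrow> reflect n u \<bullet> q = u \<bullet> q"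
  by (simp add: reflect_def inner_diff_left inner_commute[of n q])

lemma reflect_fixed: "u \<bullet> n = 0 \<Longrightarrow> reflect n u = u"
  by (simp add: reflect_def)

lemma reflect_reflect: "reflect n (reflect n u) = u"
  unfolding reflect_def[of n "reflect n u"] reflect_inner_normal
  by (simp add: reflect_def)

lemma orthogonal_transformation_reflect: "orthogonal_transformation (reflect n)"
  unfolding orthogonal_transformation_def
proof
  show "linear (reflect n)"
    by (rule linearI) (simp_all add: reflect_def inner_add_left algebra_simps add_divide_distrib)
  show "\<forall>u w. reflect n u \<bullet> reflect n w = u \<bullet> w"
    by (cases "n = 0") (simp_all add: reflect_def inner_diff_left inner_diff_right inner_commute)
qed

text \<open>Equal norms put the origin on the perpendicular bisector of \<open>p\<close> and
  \<open>q\<close>: then \<open>2 * (p \<bullet> (p - q))\<close> equals the squared length of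
  \<open>p - q\<close>, and the coefficient in the reflection is 1.\<close>

lemma reflect_swap:
  assumes "norm p = norm q"
  shows "reflect (p - q) p = q"
proof (cases "p = q")
  case False
  have "p \<bullet> p = q \<bullet> q"
    using assms by (simp add: norm_eq)
  then have eq: "2 * (p \<bullet> (p - q)) = (p - q) \<bullet> (p - q)" (is "?l = ?r")
    by (simp add: inner_diff_left inner_diff_right inner_commute)
  have "?l / ?r = 1" (is "?k = 1")
    unfolding eq by (rule divide_self) (use False in simp)
  then have "reflect (p - q) p = p - 1 *\<^sub>R (p - q)"
    unfolding reflect_def by (rule arg_cong)
  then show ?thesis
    by simp
qed (simp add: reflect_def)

lemma norm_reflect: "norm (reflect n u) = norm u"
  by (rule orthogonal_transformation_norm[OF orthogonal_transformation_reflect])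

lemma norm_reflect_diff:
  assumes "norm p = norm q"
  shows "norm (reflect (p - q) u - q) = norm (u - p)"
proof -
  have "reflect (p - q) u - q = reflect (p - q) (u - p)"
    using orthogonal_transformation_linear[OF orthogonal_transformation_reflect, of "p - q"]
    by (simp add: linear_diff reflect_swap[OF assms])
  then show ?thesis
    by (simp add: norm_reflect)
qed

section \<open>Two-point symmetrisation of tests against Gaussian weights\<close>

lemma gaussian_density_antimono:
  fixes u w :: "real ^ 'd"
  assumes "norm u \<le> norm w"
  shows "gaussian_density \<sigma> w \<le> gaussian_density \<sigma> u"
  using assms unfolding gaussian_density_def
  by (intro divide_right_mono) (auto intro!: divide_right_mono power_mono)

lemma gaussian_density_norm_cong:
  fixes u w :: "real ^ 'd"
  shows "norm u = norm w \<Longrightarrow> gaussian_density \<sigma> u = gaussian_density \<sigma> w"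
  by (simp add: gaussian_density_def)

lemma integrable_mult_soft_test:
  fixes w :: "'a::euclidean_space \<Rightarrow> real"
  assumes w: "integrable lborel w" and a: "a \<in> soft_tests"
  shows "integrable lborel (\<lambda>u. w u * a u)"
proof (rule Bochner_Integration.integrable_bound[OF w])
  show "(\<lambda>u. w u * a u) \<in> borel_measurable lborel"
    using w soft_tests_measurable[OF a] by measurable
  show "AE u in lborel. norm (w u * a u) \<le> norm (w u)"
    using soft_tests_nonneg[OF a] soft_tests_le_1[OF a] by (simp add: abs_mult mult_left_le)
qed

text \<open>Known as polarization or two-point rearrangement. On the hyperplane itself both values
  coincide, so assigning it to the maximum side is harmless.\<close>

definition polarize :: "'a::real_inner \<Rightarrow> ('a \<Rightarrow> real) \<Rightarrow> 'a \<Rightarrow> real" where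
  "polarize n a u = (if 0 \<le> u \<bullet> n then max (a u) (a (reflect n u)) else min (a u) (a (reflect n u)))"

text \<open>Maximum and minimum of a pair add up to the sum of the pair. This conservation makes the
  difference to the original test antisymmetric under the reflection.\<close>

lemma polarize_reflect: "polarize n a (reflect n u) = a u + a (reflect n u) - polarize n a u"
  using reflect_fixed[of u n]
  by (cases "u \<bullet> n" "0::real" rule: linorder_cases)
    (auto simp: polarize_def reflect_inner_normal reflect_reflect)

lemma soft_tests_reflect:
  fixes a :: "'a::euclidean_space \<Rightarrow> real"
  assumes "a \<in> soft_tests"
  shows "(\<lambda>u. a (reflect n u)) \<in> soft_tests"
proof -
  have [measurable]: "reflect n \<in> borel_measurable borel"
    unfolding reflect_def[abs_def] by measurable
  show ?thesis
    using assms unfolding soft_tests_def by auto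
qed

lemma soft_tests_polarize:
  fixes a :: "'a::euclidean_space \<Rightarrow> real"
  assumes a: "a \<in> soft_tests"
  shows "polarize n a \<in> soft_tests"
proof -
  note [measurable] = soft_tests_measurable[OF a] soft_tests_measurable[OF soft_tests_reflect[OF a]]
  have "polarize n a \<in> borel_measurable borel"
    unfolding polarize_def[abs_def] by measurable
  then show ?thesis
    using a by (auto simp: soft_tests_def polarize_def max_def min_def)
qed

lemma soft_tests_convex:
  assumes "a \<in> soft_tests" "b \<in> soft_tests" "0 \<le> t" "t \<le> 1"
  shows "(\<lambda>u. (1 - t) * a u + t * b u) \<in> soft_tests"
proof -
  have "(1 - t) * a u + t * b u \<le> (1 - t) * 1 + t * 1" for u
    using assms by (intro add_mono mult_left_mono) (auto simp: soft_tests_def)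
  then show ?thesis
    using assms by (auto simp: soft_tests_def)
qed

text \<open>The symmetrisation argument, with the base point moved to the origin. \<open>M b\<close>
  is the gradient up to the factor \<open>1 / \<sigma>\<^sup>2\<close>, so the assumption on
  \<open>M a\<close> is the comparison of angles.\<close>

lemma exists_dominated_test:
  fixes p q :: "real ^ 'd"
  assumes "\<sigma> > 0" and a: "a \<in> soft_tests" and pq: "norm p = norm q"
  defines "M \<equiv> \<lambda>b. LINT u|lborel. gaussian_density \<sigma> u *\<^sub>R b u *\<^sub>R u"
  assumes M: "M a \<bullet> q \<le> M a \<bullet> p"
  obtains b where "b \<in> soft_tests"
    and "(LINT u|lborel. gaussian_density \<sigma> u * b u) = (LINT u|lborel. gaussian_density \<sigma> u * a u)"
    and "M b = M a"
    and "(LINT u|lborel. gaussian_density \<sigma> (u - q) * b u)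
       \<le> (LINT u|lborel. gaussian_density \<sigma> (u - p) * a u)"
proof -
  define n where "n = p - q"
  let ?T = "reflect n" and ?N = "gaussian_density \<sigma>"
  note T = orthogonal_transformation_reflect[of n]
  \<comment> \<open>The reflected test attains at \<open>q\<close> the value of \<open>a\<close> at
    \<open>p\<close>, but its moment along \<open>n\<close> has the opposite sign.\<close>
  define g where "g u = a (?T u)" for u
  define b1 where "b1 = polarize n a"
  have g: "g \<in> soft_tests" and b1: "b1 \<in> soft_tests"
    using soft_tests_reflect[OF a] soft_tests_polarize[OF a] by (simp_all add: g_def[abs_def] b1_def)
  have g_T: "g (?T u) = a u" for u
    by (simp add: g_def reflect_reflect)
  have b1_T: "b1 (?T u) = a u + g u - b1 u" for u
    by (simp add: b1_def g_def polarize_reflect)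
  have N_T: "?N (?T u) = ?N u" for u
    by (rule gaussian_density_norm_cong) (simp add: norm_reflect)
  have intq: "integrable lborel (\<lambda>u. ?N u * (u \<bullet> s))" for s :: "real ^ 'd"
  proof -
    have "\<bar>u \<bullet> s\<bar> \<le> norm s * exp (1 * norm u)" for u
    proof -
      have "norm u \<le> exp (norm u)"
        using exp_ge_add_one_self[of "norm u"] by linarith
      from mult_left_mono[OF this norm_ge_zero[of s]] show ?thesis
        using Cauchy_Schwarz_ineq2[of u s] by (simp add: mult.commute)
    qed
    then show ?thesis
      using integrable_gaussian_exp_bounded[OF assms(1), of "\<lambda>u. u \<bullet> s" "norm s" 1] by simp
  qed
  have int0: "integrable lborel ?N"
    using integrable_gaussian_shift[OF assms(1), of 0] by simp
  \<comment> \<open>The component of \<open>M b\<close> along \<open>s\<close>, written as weight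
    times test so that the lemmas on antisymmetric integrands apply.\<close>
  define I where "I s b = (LINT u|lborel. (?N u * (u \<bullet> s)) * b u)" for s :: "real ^ 'd" and b
  have M_I: "M b \<bullet> s = I s b" if b: "b \<in> soft_tests" for b s
  proof -
    note [measurable] = soft_tests_measurable[OF b]
    have "norm (b u *\<^sub>R u) \<le> 1 * exp (1 * norm u)" for u
      using mult_mono[OF soft_tests_le_1[OF b, of u], of "norm u" "exp (norm u)"]
        exp_ge_add_one_self[of "norm u"] soft_tests_nonneg[OF b, of u]
      by simp
    then have "integrable lborel (\<lambda>u. ?N u *\<^sub>R b u *\<^sub>R u)"
      by (intro integrable_gaussian_exp_bounded[OF assms(1)]) measurable
    then show ?thesis
      unfolding M_def I_def by (simp add: integral_inner_left[symmetric] mult_ac del: integral_inner_left)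
  qed
  have I_diff: "I s (\<lambda>u. b u - b' u) = I s b - I s b'"
    if "b \<in> soft_tests" "b' \<in> soft_tests" for b b' s
    using integrable_mult_soft_test[OF intq that(1), of s] integrable_mult_soft_test[OF intq that(2), of s]
    by (simp add: I_def right_diff_distrib)
  have Ig: "I n g = - I n a"
  proof -
    have [measurable]: "g \<in> borel_measurable borel"
      using g by (rule soft_tests_measurable)
    have "I n g = (LINT u|lborel. (?N (?T u) * (?T u \<bullet> n)) * g (?T u))"
      unfolding I_def by (rule integral_orthogonal_transformation(1)[OF T, symmetric]) measurable
    also have "\<dots> = - I n a"
      by (simp add: N_T reflect_inner_normal g_T I_def)
    finally show ?thesis .
  qed
  \<comment> \<open>The difference \<open>a u - b1 u\<close> is at most 0 where
    \<open>u \<bullet> n\<close> is nonnegative and at least 0 on the other side, so symmetrising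
    cannot lower the moment along \<open>n\<close>.\<close>
  have Ib1: "I n a \<le> I n b1"
  proof -
    have "(LINT u|lborel. (?N u * (u \<bullet> n)) * (a u - b1 u)) \<le> 0"
    proof (rule integral_antisymmetric_nonpos[OF T])
      show "integrable lborel (\<lambda>u. (?N u * (u \<bullet> n)) * (a u - b1 u))"
        using integrable_mult_soft_test[OF intq a, of n] integrable_mult_soft_test[OF intq b1, of n]
        by (simp add: right_diff_distrib)
      fix u
      show "a (?T u) - b1 (?T u) = - (a u - b1 u)"
        by (simp add: b1_T g_def)
      have "(u \<bullet> n) * (a u - b1 u) \<le> 0"
        by (auto simp: b1_def polarize_def mult_le_0_iff)
      then have "?N u * ((u \<bullet> n) * (a u - b1 u)) \<le> 0"
        using gaussian_density_pos[OF assms(1), of u] by (simp add: mult_le_0_iff)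
      moreover have "(?N u * (u \<bullet> n) - ?N (?T u) * (?T u \<bullet> n)) * (a u - b1 u)
          = 2 * (?N u * ((u \<bullet> n) * (a u - b1 u)))"
        by (simp add: N_T reflect_inner_normal algebra_simps)
      ultimately show "(?N u * (u \<bullet> n) - ?N (?T u) * (?T u \<bullet> n)) * (a u - b1 u) \<le> 0"
        by linarith
    qed
    then show ?thesis
      using I_diff[OF a b1, of n] by (simp add: I_def)
  qed
  have Ia: "0 \<le> I n a"
    using M M_I[OF a, of n] by (simp add: n_def inner_diff_right)
  \<comment> \<open>The solution of \<open>(1 - t) * (- I n a) + t * I n b1 = I n a\<close>. It lies
    in the unit interval because \<open>I n a\<close> is nonnegative and at most
    \<open>I n b1\<close>. If the denominator is 0, both moments vanish and any weight would
    do.\<close>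
  define t where "t = 2 * I n a / (I n b1 + I n a)"
  have t: "0 \<le> t" "t \<le> 1"
    using Ia Ib1 by (auto simp: t_def divide_le_eq_1)
  have It: "(1 - t) * I n g + t * I n b1 = I n a"
  proof (cases "I n b1 + I n a = 0")
    case False
    then have "t * (I n b1 + I n a) = 2 * I n a"
      by (simp add: t_def)
    then show ?thesis
      by (simp add: Ig algebra_simps)
  next
    case True
    then have "I n a = 0" "I n b1 = 0"
      using Ia Ib1 by linarith+
    then show ?thesis
      by (simp add: Ig)
  qed
  define b where "b u = (1 - t) * g u + t * b1 u" for u
  have b: "b \<in> soft_tests"
    unfolding b_def[abs_def] by (rule soft_tests_convex[OF g b1 t])
  \<comment> \<open>Reflecting and symmetrising both preserve the sum over each pair
    \<open>u\<close>, \<open>?T u\<close>, hence so does the combination. Mass and all moments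
    orthogonal to \<open>n\<close> therefore agree with those of \<open>a\<close>; only the moment
    along \<open>n\<close> relies on the choice of \<open>t\<close>.\<close>
  have anti: "b (?T u) - a (?T u) = - (b u - a u)" for u
    by (simp add: b_def g_T b1_T g_def reflect_reflect algebra_simps)
  have int_comb: "(LINT u|lborel. w u * b u)
      = (1 - t) * (LINT u|lborel. w u * g u) + t * (LINT u|lborel. w u * b1 u)"
    if "integrable lborel w" for w
    using integrable_mult_soft_test[OF that g] integrable_mult_soft_test[OF that b1]
    by (simp add: b_def distrib_left mult.left_commute[of _ "1 - t"] mult.left_commute[of _ t])
  show ?thesis
  proof (rule that[OF b])
    have "(LINT u|lborel. ?N u * (b u - a u)) = 0"
    proof (rule integral_antisymmetric_eq_0[OF T])
      show "integrable lborel (\<lambda>u. ?N u * (b u - a u))"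
        using integrable_mult_soft_test[OF int0 b] integrable_mult_soft_test[OF int0 a]
        by (simp add: right_diff_distrib)
    qed (rule anti N_T)+
    then show "(LINT u|lborel. ?N u * b u) = (LINT u|lborel. ?N u * a u)"
      using integrable_mult_soft_test[OF int0 b] integrable_mult_soft_test[OF int0 a]
      by (simp add: right_diff_distrib)
  next
    have In: "I n b = I n a"
      using It unfolding I_def int_comb[OF intq] .
    have "M b \<bullet> s = M a \<bullet> s" for s
    proof -
      \<comment> \<open>Splits \<open>s\<close> into a part along \<open>n\<close> and a part
        orthogonal to it; \<open>n = 0\<close> gives \<open>k = 0\<close>.\<close>
      define k where "k = (s \<bullet> n) / (n \<bullet> n)"
      define s' where "s' = s - k *\<^sub>R n"
      have s': "s' \<bullet> n = 0"
        by (cases "n = 0") (simp_all add: s'_def k_def inner_diff_left)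
      have "(LINT u|lborel. (?N u * (u \<bullet> s')) * (b u - a u)) = 0"
      proof (rule integral_antisymmetric_eq_0[OF T])
        show "integrable lborel (\<lambda>u. (?N u * (u \<bullet> s')) * (b u - a u))"
          using integrable_mult_soft_test[OF intq b, of s'] integrable_mult_soft_test[OF intq a, of s']
          by (simp add: right_diff_distrib)
        show "?N (?T u) * (?T u \<bullet> s') = ?N u * (u \<bullet> s')" for u
          by (simp only: N_T reflect_inner_orthogonal[OF s'])
      qed (rule anti)
      then have "M b \<bullet> s' = M a \<bullet> s'"
        using I_diff[OF b a, of s'] unfolding M_I[OF a] M_I[OF b] I_def by linarith
      moreover have "M b \<bullet> n = M a \<bullet> n"
        unfolding M_I[OF a] M_I[OF b] by (rule In)
      ultimately have "M b \<bullet> (s' + k *\<^sub>R n) = M a \<bullet> (s' + k *\<^sub>R n)"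
        by (simp only: inner_add_right inner_scaleR_right)
      then show ?thesis
        by (simp add: s'_def)
    qed
    then show "M b = M a"
      by (rule vector_eq_rdot[THEN iffD1, OF allI])
  next
    let ?w = "\<lambda>u. ?N (u - q)"
    have w: "integrable lborel ?w"
      by (rule integrable_gaussian_shift[OF assms(1)])
    have w_T: "?w (?T u) = ?N (u - p)" for u
      unfolding n_def by (rule gaussian_density_norm_cong) (rule norm_reflect_diff[OF pq])
    \<comment> \<open>Compared with \<open>g\<close>, the symmetrised test puts the larger value of
      each pair on the side nearer to \<open>p\<close>, where the Gaussian centred at
      \<open>q\<close> has the smaller weight.\<close>
    have "(LINT u|lborel. ?w u * (b1 u - g u)) \<le> 0"
    proof (rule integral_antisymmetric_nonpos[OF T])
      show "integrable lborel (\<lambda>u. ?w u * (b1 u - g u))"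
        using integrable_mult_soft_test[OF w g] integrable_mult_soft_test[OF w b1]
        by (simp add: right_diff_distrib)
      fix u
      show "b1 (?T u) - g (?T u) = - (b1 u - g u)"
        by (simp add: b1_T g_T)
      have d: "(norm (u - q))\<^sup>2 - (norm (u - p))\<^sup>2 = 2 * (u \<bullet> n)"
        using pq by (simp add: n_def power2_norm_eq_inner norm_eq inner_diff_left inner_diff_right inner_commute)
      show "(?w u - ?w (?T u)) * (b1 u - g u) \<le> 0"
      proof (cases "0 \<le> u \<bullet> n")
        case True
        then have "(norm (u - p))\<^sup>2 \<le> (norm (u - q))\<^sup>2"
          using d by linarith
        then have "norm (u - p) \<le> norm (u - q)"
          by (rule power2_le_imp_le) simp
        then have "?w u \<le> ?w (?T u)"
          unfolding w_T by (rule gaussian_density_antimono)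
        moreover have "g u \<le> b1 u"
          using True by (simp add: b1_def g_def polarize_def)
        ultimately show ?thesis
          by (simp add: mult_le_0_iff)
      next
        case False
        then have "(norm (u - q))\<^sup>2 \<le> (norm (u - p))\<^sup>2"
          using d by linarith
        then have "norm (u - q) \<le> norm (u - p)"
          by (rule power2_le_imp_le) simp
        then have "?w (?T u) \<le> ?w u"
          unfolding w_T by (rule gaussian_density_antimono)
        moreover have "b1 u \<le> g u"
          using False by (simp add: b1_def g_def polarize_def)
        ultimately show ?thesis
          by (simp add: mult_le_0_iff)
      qed
    qed
    then have le: "(LINT u|lborel. ?w u * b1 u) \<le> (LINT u|lborel. ?w u * g u)"
      using integrable_mult_soft_test[OF w g] integrable_mult_soft_test[OF w b1]
      by (simp add: right_diff_distrib)
    have "(LINT u|lborel. ?w u * b u) \<le> (1 - t) * (LINT u|lborel. ?w u * g u) + t * (LINT u|lborel. ?w u * g u)"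
      unfolding int_comb[OF w] using le t by (intro add_left_mono mult_left_mono)
    also have "\<dots> = (LINT u|lborel. ?w u * g u)"
      by (simp add: algebra_simps)
    \<comment> \<open>The reflection carries the Gaussian centred at \<open>q\<close> to the one
      centred at \<open>p\<close>, and \<open>g\<close> back to \<open>a\<close>.\<close>
    also have "\<dots> = (LINT u|lborel. ?w (?T u) * g (?T u))"
    proof (rule integral_orthogonal_transformation(1)[OF T, symmetric])
      show "(\<lambda>u. ?w u * g u) \<in> borel_measurable borel"
        using soft_tests_measurable[OF g] by measurable
    qed
    also have "\<dots> = (LINT u|lborel. ?N (u - p) * a u)"
      by (simp add: w_T g_T)
    finally show "(LINT u|lborel. ?N (u - q) * b u) \<le> (LINT u|lborel. ?N (u - p) * a u)" .
  qed
qed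

section \<open>From tests back to classifiers and their lower bounds\<close>

text \<open>Reduces vector-valued competitors to scalar tests. Points of the simplex have norm at
  most 1, so the vector integral exists and commutes with taking a component.\<close>

lemma smoothed_component_range:
  fixes c :: "'y::finite"
  assumes "CARD('y) \<ge> 2" and "\<sigma> > 0"
  shows "(\<lambda>(h :: real ^ 'd \<Rightarrow> real ^ 'y) u. h u $ c) ` smoothed_classifiers (gaussian_density \<sigma>)
       = smooth \<sigma> ` soft_tests"
proof -
  have comp: "(\<lambda>u. (q \<star> gaussian_density \<sigma>) u $ c) = smooth \<sigma> (\<lambda>u. q u $ c)"
    if q: "q \<in> classifiers" for q :: "real ^ 'd \<Rightarrow> real ^ 'y"
  proof
    fix u
    have [measurable]: "q \<in> borel_measurable borel"
      using q by (simp add: classifiers_def)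
    have "norm (q w) \<le> 1" for w
    proof -
      have "norm (q w) \<le> (\<Sum>i\<in>UNIV. \<bar>q w $ i\<bar>)"
        by (rule norm_le_l1_cart)
      also have "\<dots> = 1"
        using q by (simp add: classifiers_def prob_simplex_def)
      finally show ?thesis .
    qed
    then have "integrable lborel (\<lambda>z. gaussian_density \<sigma> z *\<^sub>R q (u + z))"
      using assms(2) by (intro integrable_gaussian_exp_bounded[where K = 1 and C = 0]) auto
    from integral_bounded_linear[OF bounded_linear_vec_nth this, of c]
    show "(q \<star> gaussian_density \<sigma>) u $ c = smooth \<sigma> (\<lambda>u. q u $ c) u"
      by (simp add: smoothing_def smooth_def)
  qed
  have "(\<lambda>u. q u $ c) \<in> soft_tests" if "q \<in> classifiers" for q :: "real ^ 'd \<Rightarrow> real ^ 'y"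
  proof -
    have "q u $ c \<le> (\<Sum>i\<in>UNIV. q u $ i)" for u
      using that by (intro member_le_sum) (auto simp: classifiers_def prob_simplex_def)
    moreover have "(\<lambda>u. q u $ c) \<in> borel_measurable borel"
      using that by (auto simp: classifiers_def intro!: borel_measurable_continuous_on[where g = q] continuous_intros)
    ultimately show ?thesis
      using that by (auto simp: soft_tests_def classifiers_def prob_simplex_def)
  qed
  moreover have "\<exists>q \<in> classifiers. a = (\<lambda>u. q u $ c)"
    if a: "a \<in> soft_tests" for a :: "real ^ 'd \<Rightarrow> real"
  proof -
    obtain c' :: 'y where c': "c' \<noteq> c"
    proof -
      have "card (UNIV - {c}) > 0"
        using assms(1) by simp
      then have "UNIV - {c} \<noteq> {}"
        by (metis card.empty less_irrefl)
      then show ?thesis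
        using that by blast
    qed
    \<comment> \<open>A second class \<open>c'\<close> absorbs the remaining probability; this is
      where two classes are needed.\<close>
    define q where "q u = axis c (a u) + axis c' (1 - a u)" for u
    have "q = (\<lambda>u. a u *\<^sub>R axis c 1 + (1 - a u) *\<^sub>R axis c' 1)"
      by (simp add: q_def fun_eq_iff vec_eq_iff axis_def)
    then have "q \<in> borel_measurable borel"
      using soft_tests_measurable[OF a]
      by (auto intro!: borel_measurable_add borel_measurable_scaleR borel_measurable_const borel_measurable_diff)
    moreover have "q u \<in> prob_simplex" for u
      using c' soft_tests_nonneg[OF a, of u] soft_tests_le_1[OF a, of u]
      by (auto simp: prob_simplex_def q_def axis_def sum.distrib)
    moreover have "a = (\<lambda>u. q u $ c)"
      using c' by (simp add: q_def axis_def)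
    ultimately show ?thesis
      by (auto simp: classifiers_def)
  qed
  ultimately show ?thesis
    by (fastforce simp: smoothed_classifiers_def image_iff comp)
qed

text \<open>Every competitor at \<open>x + p\<close> is matched by an admissible one whose value at
  \<open>x + q\<close> is no larger, so the infima compare. The feasible \<open>h0\<close> keeps the
  infimum from being taken over the empty set, where its value in the reals carries no
  information.\<close>

lemma lower_bound_prob_mono:
  fixes c :: "'y::finite" and x y1 p q :: "real ^ 'd"
  assumes "CARD('y) \<ge> 2" and "\<sigma> > 0"
    and feasible: "h0 \<in> smoothed_classifiers (gaussian_density \<sigma>)" "h0 x $ c = y0"
      "GDERIV (\<lambda>u. h0 u $ c) x :> y1"
    and pq: "norm p = norm q" "q \<bullet> y1 \<le> p \<bullet> y1"
  shows "lower_bound_prob (gaussian_density \<sigma>) c x y0 y1 (x + q)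
       \<le> lower_bound_prob (gaussian_density \<sigma>) c x y0 y1 (x + p)"
proof -
  let ?F = "{a \<in> soft_tests. smooth \<sigma> a x = y0 \<and> (GDERIV (smooth \<sigma> a) x :> y1)}"
  note range = smoothed_component_range[OF assms(1,2), of c, where 'd = 'd]
  have comp: "\<exists>a \<in> soft_tests. (\<lambda>u. h u $ c) = smooth \<sigma> a"
    if "h \<in> smoothed_classifiers (gaussian_density \<sigma>)" for h :: "real ^ 'd \<Rightarrow> real ^ 'y"
    using imageI[OF that, of "\<lambda>h u. h u $ c"] unfolding range by auto
  \<comment> \<open>Constraints and objective see a competitor only through its component
    \<open>c\<close>, so the infimum may range over tests.\<close>
  have lbp: "lower_bound_prob (gaussian_density \<sigma>) c x y0 y1 z = Inf ((\<lambda>a. smooth \<sigma> a z) ` ?F)" for z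
  proof -
    have "{h z $ c | h. h \<in> smoothed_classifiers (gaussian_density \<sigma>) \<and> h x $ c = y0 \<and>
             (GDERIV (\<lambda>u. h u $ c) x :> y1)}
        = (\<lambda>\<phi>. \<phi> z) ` {\<phi> \<in> (\<lambda>h u. h u $ c) ` smoothed_classifiers (gaussian_density \<sigma>).
             \<phi> x = y0 \<and> (GDERIV \<phi> x :> y1)}"
      by auto
    also have "\<dots> = (\<lambda>a. smooth \<sigma> a z) ` ?F"
      unfolding range by auto
    finally show ?thesis
      by (simp add: lower_bound_prob_def)
  qed
  have nonempty: "?F \<noteq> {}"
  proof -
    obtain a where "a \<in> soft_tests" and a: "(\<lambda>u. h0 u $ c) = smooth \<sigma> a"
      using comp[OF feasible(1)] by blast
    then show ?thesis
      using feasible(2,3) fun_cong[OF a, of x] by auto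
  qed
  have bdd: "bdd_below ((\<lambda>a. smooth \<sigma> a z) ` ?F)" for z
  proof (rule bdd_belowI2)
    fix a
    assume "a \<in> ?F"
    then show "0 \<le> smooth \<sigma> a z"
      unfolding smooth_def using gaussian_density_pos[OF assms(2)]
      by (intro integral_nonneg_AE AE_I2 mult_nonneg_nonneg) (auto intro: less_imp_le soft_tests_nonneg)
  qed
  show ?thesis
    unfolding lbp
  proof (rule cINF_mono[OF nonempty bdd])
    fix a
    assume "a \<in> ?F"
    then have a: "a \<in> soft_tests" "smooth \<sigma> a x = y0" "GDERIV (smooth \<sigma> a) x :> y1"
      by auto
    have translate: "(\<lambda>u. b (s + u)) \<in> soft_tests" if "b \<in> soft_tests" for b and s :: "real ^ 'd"
    proof -
      have [measurable]: "b \<in> borel_measurable borel"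
        using that by (rule soft_tests_measurable)
      have "(\<lambda>u. b (s + u)) \<in> borel_measurable borel"
        by measurable
      then show ?thesis
        using that by (simp add: soft_tests_def)
    qed
    define M where "M b = (LINT u|lborel. gaussian_density \<sigma> u *\<^sub>R b u *\<^sub>R u)" for b :: "real ^ 'd \<Rightarrow> real"
    \<comment> \<open>Uniqueness of the derivative turns the gradient constraint into a moment
      identity.\<close>
    have y1: "y1 = (1 / \<sigma>\<^sup>2) *\<^sub>R M (\<lambda>u. a (x + u))"
      using has_derivative_unique[OF a(3)[unfolded gderiv_def] GDERIV_smooth[OF assms(2) a(1), of x, unfolded gderiv_def]]
      unfolding M_def fun_eq_iff vector_eq_ldot .
    have "M (\<lambda>u. a (x + u)) \<bullet> q \<le> M (\<lambda>u. a (x + u)) \<bullet> p"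
      using pq(2) assms(2) unfolding y1 by (simp add: inner_commute divide_le_cancel)
    then obtain b where b: "b \<in> soft_tests"
      "(LINT u|lborel. gaussian_density \<sigma> u * b u) = (LINT u|lborel. gaussian_density \<sigma> u * a (x + u))"
      "M b = M (\<lambda>u. a (x + u))"
      "(LINT u|lborel. gaussian_density \<sigma> (u - q) * b u)
         \<le> (LINT u|lborel. gaussian_density \<sigma> (u - p) * a (x + u))"
      unfolding M_def by (rule exists_dominated_test[OF assms(2) translate[OF a(1), of x] pq(1)])
    define b' where "b' w = b (- x + w)" for w
    have b': "b' \<in> soft_tests" and b'_shift: "b' (x + u) = b u" for u
      using translate[OF b(1), of "- x"] by (simp_all add: b'_def[abs_def])
    have "GDERIV (smooth \<sigma> b') x :> y1"
      using GDERIV_smooth[OF assms(2) b', of x] b(3) by (simp add: b'_shift M_def y1)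
    moreover have "smooth \<sigma> b' x = y0"
      using a(2) b(2) by (simp add: smooth_def b'_shift)
    moreover have "smooth \<sigma> b' (x + q) \<le> smooth \<sigma> a (x + p)"
      using b(4) by (simp add: smooth_shift a(1) b' b'_shift)
    ultimately show "\<exists>b\<in>?F. smooth \<sigma> b (x + q) \<le> smooth \<sigma> a (x + p)"
      using b' by blast
  qed
qed

theorem proposition2:
  fixes \<sigma> :: real
    and f g :: "real ^ 'd \<Rightarrow> real ^ 'y"
    and c :: 'y
    and x y1 :: "real ^ 'd"
    and y0 :: real
  assumes "CARD('y) \<ge> 2"
    and "\<sigma> > 0"
    and "f \<in> classifiers"
    and "g = f \<star> gaussian_density \<sigma>"
    and "y0 = g x $ c"
    and "y0 > 1 / 2"
    and "GDERIV (\<lambda>u. g u $ c) x :> y1"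
    and "y1 \<noteq> 0"
  shows "\<forall>v v'. norm v = 1 \<and> norm v' = 1 \<and> angle_between v y1 \<le> angle_between v' y1 \<longrightarrow>
           directional_robustness (gaussian_density \<sigma>) c x y0 y1 v
             \<ge> directional_robustness (gaussian_density \<sigma>) c x y0 y1 v'"
proof (intro allI impI, elim conjE)
  fix v v' :: "real ^ 'd"
  assume v: "norm v = 1" "norm v' = 1" and angle: "angle_between v y1 \<le> angle_between v' y1"
  have g: "g \<in> smoothed_classifiers (gaussian_density \<sigma>)"
    using assms(3,4) by (auto simp: smoothed_classifiers_def)
  have "\<bar>w \<bullet> y1 / (norm w * norm y1)\<bar> \<le> 1" if "norm w = 1" for w
    using Cauchy_Schwarz_ineq2[of w y1] that assms(8) by (simp add: abs_divide)
  \<comment> \<open>The Cauchy-Schwarz bound places both cosines in the interval on which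
    \<open>arccos\<close> is decreasing.\<close>
  then have "v' \<bullet> y1 / (norm v' * norm y1) \<le> v \<bullet> y1 / (norm v * norm y1)"
    using angle v by (simp add: angle_between_def arccos_le_mono)
  then have "v' \<bullet> y1 \<le> v \<bullet> y1"
    using v assms(8) by (simp add: divide_le_cancel)
  then have le: "lower_bound_prob (gaussian_density \<sigma>) c x y0 y1 (x + r *\<^sub>R v')
      \<le> lower_bound_prob (gaussian_density \<sigma>) c x y0 y1 (x + r *\<^sub>R v)" if "r \<ge> 0" for r
    using that v assms(5,7)
    by (intro lower_bound_prob_mono[OF assms(1,2) g]) (auto intro: mult_left_mono)
  \<comment> \<open>Every radius certified along \<open>v'\<close> is certified along
    \<open>v\<close>; the suprema then compare by inclusion of sets.\<close>
  have "r *\<^sub>R v \<in> safety_region (gaussian_density \<sigma>) c x y0 y1"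
    if "r \<ge> 0" "r *\<^sub>R v' \<in> safety_region (gaussian_density \<sigma>) c x y0 y1" for r
    using le[OF that(1)] that(2) unfolding safety_region_def mem_Collect_eq by linarith
  then show "directional_robustness (gaussian_density \<sigma>) c x y0 y1 v'
      \<le> directional_robustness (gaussian_density \<sigma>) c x y0 y1 v"
    unfolding directional_robustness_def by (intro Sup_subset_mono) blast
qed

end
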